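(* Fix integers $s\geq r\geq 3$ and $\ell\geq 2$. Then there exists a constant $c(s,r,\ell)$ such that for all sufficiently large $n$, $$\mathrm{ex}_r(n,K_s^{(r)},S_\ell^r)\leq c(s,r,\ell)\,n^{r-2}.$$ Moreover, if $s\leq \ell+r-2$, then $\mathrm{ex}_r(n,K_s^{(r)},S_\ell^r)=\Theta(n^{r-2})$.
   Context: An $r$-graph is a hypergraph all of whose hyperedges have exactly $r$ vertices. $K_s^{(r)}$ is the complete $r$-graph on $s$ vertices. $S_\ell$ is the star with $\ell$ edges. For a graph $F$, the $r$-expansion $F^r$ is obtained from $F$ by adding $r-2$ new vertices to each edge, all new vertices distinct from each other and from $V(F)$. $\mathrm{ex}_r(n,\mathcal{H},\mathcal{F})$ is the maximum number of copies of $\mathcal{H}$ in an $n$-vertex $r$-graph containing no copy of $\mathcal{F}$. *)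

theory Defs
  imports Complex_Main "HOL-Library.Landau_Symbols"
begin

type_synonym 'a hgraph = "'a set \<times> 'a set set"

abbreviation verts :: "'a hgraph \<Rightarrow> 'a set" where
  "verts G \<equiv> fst G"

abbreviation edges :: "'a hgraph \<Rightarrow> 'a set set" where
  "edges G \<equiv> snd G"

definition r_graph :: "nat \<Rightarrow> 'a hgraph \<Rightarrow> bool" where
  "r_graph r G \<longleftrightarrow> finite (verts G) \<and> (\<forall>e\<in>edges G. e \<subseteq> verts G \<and> card e = r)"

definition hg_iso :: "'a hgraph \<Rightarrow> 'b hgraph \<Rightarrow> bool" where
  "hg_iso G H \<longleftrightarrow> (\<exists>f. bij_betw f (verts G) (verts H) \<and> (\<lambda>e. f ` e) ` edges G = edges H)"

definition subhypergraph :: "'a hgraph \<Rightarrow> 'a hgraph \<Rightarrow> bool" where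
  "subhypergraph H G \<longleftrightarrow> verts H \<subseteq> verts G \<and> edges H \<subseteq> edges G \<and> (\<forall>e\<in>edges H. e \<subseteq> verts H)"

text \<open>Copies are unlabelled and not necessarily induced: a copy is a subhypergraph, so
  different isomorphisms onto the same subhypergraph are counted once.\<close>

definition copies :: "'a hgraph \<Rightarrow> 'b hgraph \<Rightarrow> 'b hgraph set" where
  "copies H G = {H'. subhypergraph H' G \<and> hg_iso H H'}"

definition complete_r_graph :: "nat \<Rightarrow> nat \<Rightarrow> nat hgraph" where
  "complete_r_graph s r = ({..<s}, {e. e \<subseteq> {..<s} \<and> card e = r})"

definition star :: "nat \<Rightarrow> nat hgraph" where
  "star l = ({0..l}, {{0, i} | i. i \<in> {1..l}})"

text \<open>The new vertices added to an edge \<open>e\<close> are the pairs \<open>(e, i)\<close> with \<open>i < r - 2\<close>, tagged by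
  \<open>Inr\<close>; the original vertices are tagged by \<open>Inl\<close>.\<close>

definition expansion :: "nat \<Rightarrow> 'a hgraph \<Rightarrow> ('a + 'a set \<times> nat) hgraph" where
  "expansion r F =
    (Inl ` verts F \<union> Inr ` (edges F \<times> {..<r - 2}),
     (\<lambda>e. Inl ` e \<union> Inr ` ({e} \<times> {..<r - 2})) ` edges F)"

text \<open>Every \<open>n\<close>-vertex hypergraph is isomorphic to one whose vertices are natural numbers, so
  the maximum may be taken over these.\<close>

definition ex_r :: "nat \<Rightarrow> nat \<Rightarrow> 'a hgraph \<Rightarrow> 'b hgraph \<Rightarrow> nat" where
  "ex_r r n H F =
    Max {card (copies H G) | G :: nat hgraph.
           r_graph r G \<and> card (verts G) = n \<and> copies F G = {}}"

lemma finite_ex_r_values: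
  "finite {card (copies H G) | G :: nat hgraph.
     r_graph r G \<and> card (verts G) = n \<and> copies F G = {}}"
proof (rule finite_subset)
  show "{card (copies H G) | G :: nat hgraph.
     r_graph r G \<and> card (verts G) = n \<and> copies F G = {}} \<subseteq> {..2 ^ n * 2 ^ 2 ^ n}"
  proof
    fix k
    assume "k \<in> {card (copies H G) | G :: nat hgraph.
      r_graph r G \<and> card (verts G) = n \<and> copies F G = {}}"
    then obtain V :: "nat set" and E
      where G: "r_graph r (V, E)" and n: "card V = n" and k: "k = card (copies H (V, E))"
      by auto
    have V: "finite V" and E: "E \<subseteq> Pow V"
      using G by (auto simp: r_graph_def)
    have sub: "copies H (V, E) \<subseteq> Pow V \<times> Pow (Pow V)"
      using E by (fastforce simp: copies_def subhypergraph_def)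
    have "card (copies H (V, E)) \<le> card (Pow V \<times> Pow (Pow V))"
      using V by (intro card_mono sub) auto
    also have "\<dots> = 2 ^ card V * 2 ^ 2 ^ card V"
      using V by (simp add: card_cartesian_product card_Pow)
    finally show "k \<in> {..2 ^ n * 2 ^ 2 ^ n}"
      by (simp add: k n)
  qed
qed simp

lemma ex_r_values_nonempty:
  assumes "edges F \<noteq> {}"
  shows "{card (copies H G) | G :: nat hgraph.
     r_graph r G \<and> card (verts G) = n \<and> copies F G = {}} \<noteq> {}"
proof -
  have "r_graph r ({..<n}, {})" "card (verts ({..<n}, {} :: nat set set)) = n"
    "copies F ({..<n}, {}) = {}"
    using assms by (auto simp: r_graph_def copies_def subhypergraph_def hg_iso_def)
  then show ?thesis by blast
qed

end

theory Submission
  imports Defs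
begin

text \<open>
  An \<open>r\<close>-graph is \<open>S\<^sub>l\<^sup>r\<close>-free iff no vertex link contains \<open>l\<close> disjoint sets, so every vertex
  \<open>v\<close> has a set \<open>T v\<close> of bounded size, not containing \<open>v\<close>, that meets every edge through \<open>v\<close>.
  In an \<open>s\<close>-clique \<open>K\<close> at most \<open>r - 2\<close> vertices other than \<open>v\<close> avoid \<open>T v\<close>, so the digraph
  \<open>v \<rightarrow> w \<in> T v\<close> has minimum out-degree at least \<open>s - r + 1\<close> on \<open>K\<close>. This forces some \<open>r - 2\<close>
  vertices of \<open>K\<close> to reach all of \<open>K\<close>; as out-degrees are bounded, each \<open>(r - 2)\<close>-set accounts
  for boundedly many cliques. For the lower bound, fix a core of \<open>s - r + 2 \<le> l\<close> vertices and
  take all \<open>r\<close>-sets with at least two vertices in the core: the core together with any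
  \<open>r - 2\<close> further vertices is a clique.
\<close>

section \<open>Copies of expanded stars and of complete hypergraphs\<close>

lemma edges_expansion_star:
  "edges (expansion r (star l)) =
    (\<lambda>i. Inl ` {0, i} \<union> Inr ` ({{0, i}} \<times> {..<r - 2})) ` {1..l}"
proof -
  have "edges (star l) = (\<lambda>i. {0, i}) ` {1..l}" by (auto simp: star_def)
  then show ?thesis by (simp add: expansion_def image_image)
qed

lemma verts_expansion_star:
  "verts (expansion r (star l)) =
    insert (Inl 0) (Inl ` {1..l} \<union> (\<lambda>(i, j). Inr ({0, i}, j)) ` ({1..l} \<times> {..<r - 2}))"
proof -
  have "verts (star l) = insert 0 {1..l}" "edges (star l) = (\<lambda>i. {0, i}) ` {1..l}"
    by (auto simp: star_def)
  moreover have "(Inr :: _ \<Rightarrow> nat + _) ` ((\<lambda>i. {0, i}) ` {1..l} \<times> {..<r - 2}) =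
      (\<lambda>(i, j). Inr ({0, i}, j)) ` ({1..l} \<times> {..<r - 2})"
    by (auto simp: image_iff)
  ultimately show ?thesis by (simp add: expansion_def)
qed

text \<open>Two edges of the expanded star share only the centre, and an injective map preserves
  intersections.\<close>

lemma copies_expansion_starD:
  assumes "copies (expansion r (star l)) G \<noteq> {}"
  obtains v f where "\<And>i. i \<in> {1..l} \<Longrightarrow> f i \<in> edges G \<and> v \<in> f i"
    and "\<And>i j. i \<in> {1..l} \<Longrightarrow> j \<in> {1..l} \<Longrightarrow> i \<noteq> j \<Longrightarrow> f i \<inter> f j = {v}"
proof -
  define E :: "nat \<Rightarrow> (nat + nat set \<times> nat) set"
    where "E i = Inl ` {0, i} \<union> Inr ` ({{0, i}} \<times> {..<r - 2})" for i
  obtain H h where sub: "subhypergraph H G"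
    and bij: "bij_betw h (verts (expansion r (star l))) (verts H)"
    and img: "(\<lambda>e. h ` e) ` edges (expansion r (star l)) = edges H"
    using assms by (auto simp: copies_def hg_iso_def)
  have inj: "inj_on h (verts (expansion r (star l)))"
    using bij by (rule bij_betw_imp_inj_on)
  have E_sub: "E i \<subseteq> verts (expansion r (star l))" if "i \<in> {1..l}" for i
    using that by (force simp: E_def verts_expansion_star)
  have "h ` E i \<in> edges G \<and> h (Inl 0) \<in> h ` E i" if "i \<in> {1..l}" for i
  proof -
    have "E i \<in> edges (expansion r (star l))"
      using that by (simp add: edges_expansion_star E_def)
    then have "h ` E i \<in> edges H" using img by blast
    then show ?thesis
      using sub by (auto simp: subhypergraph_def E_def)
  qed
  moreover have "h ` E i \<inter> h ` E j = {h (Inl 0)}"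
    if "i \<in> {1..l}" "j \<in> {1..l}" "i \<noteq> j" for i j
  proof -
    have "E i \<inter> E j = {Inl 0}" using that by (auto simp: E_def doubleton_eq_iff)
    then show ?thesis
      using inj_on_image_Int[OF inj E_sub E_sub, OF that(1,2)] by simp
  qed
  ultimately show ?thesis by (rule that)
qed

text \<open>The petal \<open>f i - {v}\<close> has \<open>r - 1\<close> vertices, enumerated by
  \<open>g i\<close>: indices below \<open>r - 2\<close> serve the new vertices of the expansion,
  index \<open>r - 2\<close> serves the leaf. Disjointness of the petals makes the resulting map
  \<open>h\<close> injective.\<close>

lemma copies_expansion_starI:
  assumes G: "r_graph r G" and r: "r \<ge> 2" and l: "l \<ge> 1"
    and f: "\<And>i. i \<in> {1..l} \<Longrightarrow> f i \<in> edges G \<and> v \<in> f i"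
    and disj: "\<And>i j. i \<in> {1..l} \<Longrightarrow> j \<in> {1..l} \<Longrightarrow> i \<noteq> j \<Longrightarrow> f i \<inter> f j = {v}"
  shows "copies (expansion r (star l)) G \<noteq> {}"
proof -
  have fin: "finite (f i)" and card_f: "card (f i) = r" and f_sub: "f i \<subseteq> verts G"
    if "i \<in> {1..l}" for i
    using G f[OF that] by (auto simp: r_graph_def intro: finite_subset)
  have "\<forall>i\<in>{1..l}. \<exists>g. bij_betw g {..<r - 1} (f i - {v})"
    using fin card_f f by (intro ballI finite_same_card_bij) auto
  then obtain g where g: "\<And>i. i \<in> {1..l} \<Longrightarrow> bij_betw (g i) {..<r - 1} (f i - {v})"
    by metis
  have g_in: "g i j \<in> f i - {v}" if "i \<in> {1..l}" "j < r - 1" for i j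
    using bij_betwE[OF g[OF that(1)]] that(2) by blast
  have g_inj: "i = i' \<and> j = j'"
    if "g i j = g i' j'" "i \<in> {1..l}" "j < r - 1" "i' \<in> {1..l}" "j' < r - 1" for i i' j j'
  proof
    show "i = i'" using disj[of i i'] g_in[of i j] g_in[of i' j'] that by auto
    then show "j = j'"
      using bij_betw_imp_inj_on[OF g[OF that(2)]] that by (auto dest: inj_onD)
  qed
  \<comment> \<open>\<open>Max\<close> recovers the leaf \<open>i\<close> from the edge \<open>{0, i}\<close>.\<close>
  define h where "h x = (case x of Inl i \<Rightarrow> if i = 0 then v else g i (r - 2)
    | Inr (e, j) \<Rightarrow> g (Max e) j)" for x
  have h_simps: "h (Inl 0) = v" "i \<in> {1..l} \<Longrightarrow> h (Inl i) = g i (r - 2)"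
    "h (Inr ({0, i}, j)) = g i j" for i j
    by (auto simp: h_def)
  let ?X = "expansion r (star l)"
  have h_edge: "h ` (Inl ` {0, i} \<union> Inr ` ({{0, i}} \<times> {..<r - 2})) = f i"
    if i: "i \<in> {1..l}" for i
  proof -
    have "{..<r - 1} = insert (r - 2) {..<r - 2}" using r by auto
    then have "insert v (insert (g i (r - 2)) (g i ` {..<r - 2})) = insert v (g i ` {..<r - 1})"
      by simp
    also have "\<dots> = f i"
      using bij_betw_imp_surj_on[OF g[OF i]] f[OF i] by auto
    finally have "insert v (insert (g i (r - 2)) (g i ` {..<r - 2})) = f i" .
    moreover have "h ` (Inl ` {0, i} \<union> Inr ` ({{0, i}} \<times> {..<r - 2})) =
      insert v (insert (g i (r - 2)) (g i ` {..<r - 2}))"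
    proof -
      have "h ` Inr ` ({{0, i}} \<times> {..<r - 2}) = g i ` {..<r - 2}"
        using h_simps(3) by (force simp: image_iff)
      then show ?thesis using h_simps(1,2) i by (simp add: image_Un)
    qed
    ultimately show ?thesis by simp
  qed
  have img: "(\<lambda>e. h ` e) ` edges ?X = f ` {1..l}"
    unfolding edges_expansion_star image_image by (intro image_cong h_edge refl)
  have g1: "g i (r - 2) \<noteq> v" "v \<noteq> g i (r - 2)" if "i \<in> {1..l}" for i
    using g_in[OF that, of "r - 2"] r by force+
  have g2: "g i j \<noteq> v" "v \<noteq> g i j" if "i \<in> {1..l}" "j < r - 2" for i j
    using g_in[OF that(1), of j] that(2) by force+
  have "inj_on h (verts ?X)"
  proof (rule inj_onI)
    fix x y assume xy: "x \<in> verts ?X" "y \<in> verts ?X" "h x = h y"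
    have cases: "z = Inl 0 \<or> (\<exists>i\<in>{1..l}. z = Inl i) \<or> (\<exists>i\<in>{1..l}. \<exists>j<r - 2. z = Inr ({0, i}, j))"
      if "z \<in> verts ?X" for z
      using that by (auto simp: verts_expansion_star)
    show "x = y"
      using cases[OF xy(1)] cases[OF xy(2)]
      by (elim disjE bexE exE conjE)
        (use xy(3) r in \<open>auto simp: h_simps g1 g2 dest: g_inj\<close>)
  qed
  then have "hg_iso ?X (h ` verts ?X, f ` {1..l})"
    using img by (auto simp: hg_iso_def intro!: exI[of _ h] inj_on_imp_bij_betw)
  \<comment> \<open>Since \<open>l \<ge> 1\<close>, the centre also lies in an edge; so the image of
    the vertex set is the union of the \<open>f i\<close> and stays inside \<open>G\<close>.\<close>
  moreover have verts: "verts ?X = \<Union>(edges ?X)"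
    using l by (force simp: verts_expansion_star edges_expansion_star)
  have "h ` verts ?X = \<Union>(f ` {1..l})"
    using img unfolding verts by (metis image_Union)
  then have "subhypergraph (h ` verts ?X, f ` {1..l}) G"
    using f f_sub by (fastforce simp: subhypergraph_def)
  ultimately show ?thesis by (auto simp: copies_def)
qed

lemma hg_iso_complete_iff:
  "hg_iso (complete_r_graph s r) H \<longleftrightarrow>
    finite (verts H) \<and> card (verts H) = s \<and> edges H = {e. e \<subseteq> verts H \<and> card e = r}"
proof -
  have img: "(\<lambda>e. f ` e) ` {e. e \<subseteq> {..<s} \<and> card e = r} = {e. e \<subseteq> W \<and> card e = r}"
    if f: "bij_betw f {..<s} W" for f and W :: "'a set"
  proof -
    have inj: "inj_on f {..<s}" and W: "W = f ` {..<s}"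
      using f by (auto simp: bij_betw_def)
    show ?thesis
      unfolding W
      by (auto simp: subset_image_iff card_image inj_on_subset[OF inj] image_iff)
  qed
  show ?thesis
  proof
    assume "hg_iso (complete_r_graph s r) H"
    then obtain f where f: "bij_betw f {..<s} (verts H)"
      and e: "(\<lambda>e. f ` e) ` {e. e \<subseteq> {..<s} \<and> card e = r} = edges H"
      by (auto simp: hg_iso_def complete_r_graph_def)
    then show "finite (verts H) \<and> card (verts H) = s \<and> edges H = {e. e \<subseteq> verts H \<and> card e = r}"
      using img[OF f] bij_betw_finite[OF f] bij_betw_same_card[OF f] by auto
  next
    assume H: "finite (verts H) \<and> card (verts H) = s \<and> edges H = {e. e \<subseteq> verts H \<and> card e = r}"
    then obtain f where f: "bij_betw f {..<s} (verts H)"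
      by (metis card_lessThan finite_lessThan finite_same_card_bij)
    then show "hg_iso (complete_r_graph s r) H"
      using img[OF f] H by (auto simp: hg_iso_def complete_r_graph_def)
  qed
qed

definition cliques :: "nat \<Rightarrow> nat \<Rightarrow> 'a hgraph \<Rightarrow> 'a set set" where
  "cliques s r G =
    {K. finite K \<and> K \<subseteq> verts G \<and> card K = s \<and> (\<forall>e\<subseteq>K. card e = r \<longrightarrow> e \<in> edges G)}"

text \<open>The vertex set of a copy forces its edge set, so copies may be counted as sets of
  vertices.\<close>

lemma card_copies_complete: "card (copies (complete_r_graph s r) G) = card (cliques s r G)"
proof -
  let ?f = "\<lambda>K. (K, {e. e \<subseteq> K \<and> card e = r})"
  have "copies (complete_r_graph s r) G = ?f ` cliques s r G"
  proof (intro equalityI subsetI)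
    fix H assume "H \<in> copies (complete_r_graph s r) G"
    then have H: "subhypergraph H G" "finite (verts H)" "card (verts H) = s"
      and eq: "edges H = {e. e \<subseteq> verts H \<and> card e = r}"
      by (simp_all add: copies_def hg_iso_complete_iff)
    have "H = ?f (verts H)" using eq by (simp add: prod_eq_iff)
    moreover have "verts H \<in> cliques s r G"
      using H unfolding cliques_def subhypergraph_def eq by blast
    ultimately show "H \<in> ?f ` cliques s r G" by blast
  next
    fix H assume "H \<in> ?f ` cliques s r G"
    then obtain K where "K \<in> cliques s r G" "H = ?f K" by blast
    then show "H \<in> copies (complete_r_graph s r) G"
      by (simp add: copies_def hg_iso_complete_iff subhypergraph_def cliques_def subset_iff)
  qed
  then show ?thesis
    by (simp add: card_image inj_on_def)
qed

section \<open>The upper bound\<close>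

text \<open>\<open>T\<close> is the union of a maximal family \<open>M\<close> of disjoint sets in
  the link \<open>L\<close> of \<open>v\<close>. Having \<open>l\<close> such sets would give an
  expanded star, which bounds \<open>M\<close>; maximality makes the union meet every set of the
  link.\<close>

lemma link_cover:
  assumes G: "r_graph r G" and r: "r \<ge> 2" and l: "l \<ge> 1"
    and free: "copies (expansion r (star l)) G = {}"
  obtains T where "finite T" "v \<notin> T" "card T \<le> (l - 1) * (r - 1)"
    "\<And>e. e \<in> edges G \<Longrightarrow> v \<in> e \<Longrightarrow> e \<inter> T \<noteq> {}"
proof -
  define L where "L = {e - {v} | e. e \<in> edges G \<and> v \<in> e}"
  have finV: "finite (verts G)" and edge: "\<And>e. e \<in> edges G \<Longrightarrow> e \<subseteq> verts G \<and> card e = r"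
    using G by (auto simp: r_graph_def)
  have L: "finite a \<and> card a = r - 1 \<and> v \<notin> a \<and> insert v a \<in> edges G" if "a \<in> L" for a
    using that edge finV by (auto simp: L_def insert_absorb intro: finite_subset)
  have "L \<subseteq> Pow (verts G)" using edge by (auto simp: L_def)
  then have finL: "finite L" using finV by (meson finite_Pow_iff finite_subset)
  define P where "P = {M. M \<subseteq> L \<and> pairwise disjnt M}"
  have "finite P" using finL by (auto simp: P_def)
  moreover have "{} \<in> P" by (simp add: P_def)
  ultimately obtain M where M: "M \<in> P" and max: "\<And>M'. M' \<in> P \<Longrightarrow> M \<subseteq> M' \<Longrightarrow> M = M'"
    using finite_has_maximal[of P] by (metis empty_iff)
  have M_sub: "M \<subseteq> L" and Md: "pairwise disjnt M" using M by (auto simp: P_def)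
  have finM: "finite M" using M_sub finL by (rule finite_subset)
  have "card M < l"
  proof (rule ccontr)
    assume "\<not> card M < l"
    then obtain N where N: "N \<subseteq> M" "card N = l" "finite N"
      by (metis not_less obtain_subset_with_card_n)
    then obtain b where b: "bij_betw b {1..l} N"
      by (metis card_atLeastAtMost diff_Suc_1 finite_atLeastAtMost finite_same_card_bij)
    have bM: "b i \<in> M" if "i \<in> {1..l}" for i using bij_betwE[OF b] N(1) that by blast
    have "copies (expansion r (star l)) G \<noteq> {}"
    proof (rule copies_expansion_starI[OF G r l, where f = "\<lambda>i. insert v (b i)" and v = v])
      show "insert v (b i) \<in> edges G \<and> v \<in> insert v (b i)" if "i \<in> {1..l}" for i
        using L bM[OF that] M_sub by blast
      show "insert v (b i) \<inter> insert v (b j) = {v}"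
        if "i \<in> {1..l}" "j \<in> {1..l}" "i \<noteq> j" for i j
      proof -
        have "b i \<noteq> b j"
          using bij_betw_imp_inj_on[OF b] that by (auto dest: inj_onD)
        then have "b i \<inter> b j = {}"
          using Md bM that by (auto simp: pairwise_def disjnt_def)
        then show ?thesis by auto
      qed
    qed
    then show False using free by simp
  qed
  show ?thesis
  proof
    show "finite (\<Union>M)" "v \<notin> \<Union>M" using finM M_sub L by auto
    have "card (\<Union>M) \<le> (\<Sum>a\<in>M. card a)" by (rule card_Union_le_sum_card)
    also have "\<dots> = card M * (r - 1)" using M_sub L by (simp add: subset_iff)
    also have "\<dots> \<le> (l - 1) * (r - 1)" using \<open>card M < l\<close> by (intro mult_right_mono) auto
    finally show "card (\<Union>M) \<le> (l - 1) * (r - 1)" .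
    show "e \<inter> \<Union>M \<noteq> {}" if e: "e \<in> edges G" "v \<in> e" for e
    proof
      assume *: "e \<inter> \<Union>M = {}"
      have eL: "e - {v} \<in> L" using e by (auto simp: L_def)
      moreover have "disjnt (e - {v}) a \<and> disjnt a (e - {v})" if "a \<in> M" for a
        using * that by (auto simp: disjnt_def)
      ultimately have "insert (e - {v}) M \<in> P"
        using M_sub Md by (simp add: P_def pairwise_insert)
      then have "e - {v} \<in> M" using max[of "insert (e - {v}) M"] by blast
      then have "e - {v} = {}" using * by blast
      then have "card (e - {v}) = 0" by (simp only: card.empty)
      then show False using L[OF eL] r by simp
    qed
  qed
qed

section \<open>Generating sets and balls in digraphs\<close>

definition arcs_in :: "'a set \<Rightarrow> ('a \<Rightarrow> 'a set) \<Rightarrow> ('a \<times> 'a) set" where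
  "arcs_in K T = {(u, w). u \<in> K \<and> w \<in> K \<and> w \<in> T u}"

text \<open>An inclusion-minimal generating set \<open>R\<close> is an antichain for reachability. If it had
  \<open>card K - m\<close> elements, then \<open>K - R\<close> would be the out-neighbourhood of every element of \<open>R\<close>,
  while each vertex of \<open>K - R\<close> has too few out-neighbours outside \<open>R\<close>; so one element of \<open>R\<close>
  would reach another in two steps.\<close>

lemma small_generating_set:
  assumes fin: "finite K" and m: "m \<ge> 1" and K: "card K \<ge> m + 2"
    and deg: "\<And>v. v \<in> K \<Longrightarrow> v \<notin> T v \<and> card (K \<inter> T v) \<ge> m"
  obtains R where "R \<subseteq> K" "card R + m + 1 \<le> card K" "K \<subseteq> (arcs_in K T)\<^sup>* `` R"
proof -
  let ?E = "arcs_in K T"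
  define P where "P = {R. R \<subseteq> K \<and> K \<subseteq> ?E\<^sup>* `` R}"
  have "finite P" "K \<in> P" using fin by (auto simp: P_def)
  then obtain R where R: "R \<in> P" and min: "\<And>R'. R' \<in> P \<Longrightarrow> R' \<subseteq> R \<Longrightarrow> R = R'"
    using finite_has_minimal[of P] by (metis empty_iff)
  have RK: "R \<subseteq> K" and gen: "K \<subseteq> ?E\<^sup>* `` R" using R by (auto simp: P_def)
  \<comment> \<open>If \<open>v\<close> reached another element \<open>w\<close>, then
    \<open>R - {w}\<close> would still generate, against minimality.\<close>
  have antichain: "v = w" if "v \<in> R" "w \<in> R" "(v, w) \<in> ?E\<^sup>*" for v w
  proof (rule ccontr)
    assume "v \<noteq> w"
    have "K \<subseteq> ?E\<^sup>* `` (R - {w})"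
    proof
      fix x assume "x \<in> K"
      then obtain u where "u \<in> R" "(u, x) \<in> ?E\<^sup>*" using gen by auto
      then show "x \<in> ?E\<^sup>* `` (R - {w})"
        using that \<open>v \<noteq> w\<close> by (cases "u = w") (auto intro: rtrancl_trans)
    qed
    then have "R - {w} \<in> P" using RK by (auto simp: P_def)
    then show False using min[of "R - {w}"] \<open>w \<in> R\<close> by blast
  qed
  have out: "K \<inter> T v \<subseteq> K - R" if v: "v \<in> R" for v
  proof
    fix w assume w: "w \<in> K \<inter> T v"
    then have "(v, w) \<in> ?E\<^sup>*" using RK v by (auto simp: arcs_in_def)
    then show "w \<in> K - R" using w antichain[of v w] v deg[of v] RK by auto
  qed
  have cR: "card (K - R) + card R = card K"
    using fin RK by (simp add: card_Diff_subset card_mono finite_subset)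
  have "card (K - R) \<ge> m + 1"
  proof (rule ccontr)
    assume "\<not> card (K - R) \<ge> m + 1"
    then have small: "card (K - R) \<le> m" by simp
    have out_eq: "K \<inter> T v = K - R" if "v \<in> R" for v
      using card_seteq[OF _ out[OF that]] fin small deg[of v] that RK by force
    \<comment> \<open>Here the hypothesis \<open>card K \<ge> m + 2\<close> enters: two elements of
      \<open>R\<close> are needed for the contradiction.\<close>
    have "card R \<ge> 2" using small K cR by linarith
    then obtain v v' where v: "v \<in> R" "v' \<in> R" "v \<noteq> v'"
      using card_le_Suc0_iff_eq[OF finite_subset[OF RK fin]] by fastforce
    have "card (K - R) \<ge> m" using deg[of v] out_eq[OF v(1)] v(1) RK by auto
    then obtain u where u: "u \<in> K - R" using m by (metis card.empty ex_in_conv not_one_le_zero order_trans)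
    \<comment> \<open>As \<open>u\<close> is not its own out-neighbour, at most \<open>m - 1\<close>
      of its out-neighbours lie in \<open>K - R\<close>, so one of them lies in
      \<open>R\<close>.\<close>
    have "\<not> K \<inter> T u \<subseteq> K - R - {u}"
    proof
      assume "K \<inter> T u \<subseteq> K - R - {u}"
      then have "card (K \<inter> T u) \<le> card (K - R - {u})" using fin by (intro card_mono) auto
      also have "\<dots> < card (K - R)" using fin u by (intro card_Diff1_less) auto
      finally show False using small deg[of u] u by auto
    qed
    then obtain w where w: "w \<in> R" "w \<in> T u" using deg[of u] u by blast
    have step: "(x, w) \<in> ?E\<^sup>*" if "x \<in> R" for x
    proof -
      have "(x, u) \<in> ?E" "(u, w) \<in> ?E"
        using that RK u w out_eq[OF that] by (auto simp: arcs_in_def)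
      then show ?thesis by auto
    qed
    show False using antichain[OF _ w(1) step] v by metis
  qed
  then show ?thesis using that[OF RK _ gen] cR by linarith
qed

text \<open>Keeping \<open>u\<close> makes the iterates increase, so they are balls.
  \<open>T u\<close> is not cut down to a clique, so a ball depends only on its starting set and
  serves all cliques generated by that set.\<close>

definition ball_step :: "('a \<Rightarrow> 'a set) \<Rightarrow> 'a set \<Rightarrow> 'a set" where
  "ball_step T X = (\<Union>u\<in>X. insert u (T u))"

text \<open>A closed out-neighbourhood has at most \<open>d + 1\<close> elements, so each step
  multiplies the size by at most that factor.\<close>

lemma card_ball_step_iterate:
  assumes T: "\<And>v. finite (T v) \<and> card (T v) \<le> d" and R: "finite R"
  shows "finite ((ball_step T ^^ k) R) \<and> card ((ball_step T ^^ k) R) \<le> card R * (d + 1) ^ k"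
proof (induction k)
  case (Suc k)
  let ?X = "(ball_step T ^^ k) R"
  have "card (ball_step T ?X) \<le> (\<Sum>u\<in>?X. card (insert u (T u)))"
    using card_UN_le[of ?X "\<lambda>u. insert u (T u)"] Suc.IH by (simp add: ball_step_def)
  also have "\<dots> \<le> (\<Sum>u\<in>?X. d + 1)"
    using T by (intro sum_mono) (metis Suc_eq_plus1 card_insert_le_m1 card_insert_if le_SucI not_less_eq_eq)
  also have "\<dots> \<le> card R * (d + 1) ^ k * (d + 1)"
    using Suc by (simp only: sum_constant mult_right_mono of_nat_id)
  finally have "card (ball_step T ?X) \<le> card R * (d + 1) ^ Suc k" by (simp add: mult_ac)
  moreover have "finite (ball_step T ?X)"
    unfolding ball_step_def[of T ?X] using Suc.IH T by blast
  ultimately show ?case by simp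
qed (use R in simp)

text \<open>Reachability needs no more steps than there are arcs, and the digraph on
  \<open>K\<close> has at most \<open>card K * card K\<close> of them. This radius does not depend
  on the clique beyond its size.\<close>

lemma subset_ball_step_iterate:
  assumes fin: "finite K" and gen: "K \<subseteq> (arcs_in K T)\<^sup>* `` R"
  shows "K \<subseteq> (ball_step T ^^ (card K * card K)) R"
proof -
  let ?E = "arcs_in K T"
  have sub: "?E \<subseteq> K \<times> K" by (auto simp: arcs_in_def)
  then have finE: "finite ?E" using fin by (meson finite_SigmaI finite_subset)
  have cE: "card ?E \<le> card K * card K"
    using card_mono[OF _ sub] fin by (simp add: card_cartesian_product)
  have step: "x \<in> (ball_step T ^^ k) R" if "v \<in> R" "(v, x) \<in> ?E ^^ k" for v x k
    using that(2)
  proof (induction k arbitrary: x)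
    case (Suc k)
    then obtain y where "(v, y) \<in> ?E ^^ k" "x \<in> T y" by (auto simp: arcs_in_def)
    then show ?case using Suc.IH by (auto simp: ball_step_def)
  qed (use that(1) in simp)
  have mono: "(ball_step T ^^ k) R \<subseteq> (ball_step T ^^ k') R" if "k \<le> k'" for k k'
    using that by (rule lift_Suc_mono_le[rotated]) (auto simp: ball_step_def)
  show ?thesis
  proof
    fix x assume "x \<in> K"
    then obtain v where v: "v \<in> R" "(v, x) \<in> ?E\<^sup>*" using gen by auto
    then obtain k where "k \<le> card ?E" "(v, x) \<in> ?E ^^ k"
      using rtrancl_finite_eq_relpow[OF finE] by auto
    then show "x \<in> (ball_step T ^^ (card K * card K)) R"
      using step[OF v(1)] mono cE by (meson order_trans subsetD)
  qed
qed

text \<open>The exponent of 2 bounds the size of a ball around \<open>r - 2\<close> vertices, so the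
  power of 2 bounds the cliques inside one ball; the other factor bounds the number of
  balls.\<close>

lemma card_cliques_le:
  assumes G: "r_graph r G" and r: "r \<ge> 3" and s: "s \<ge> r" and l: "l \<ge> 1"
    and free: "copies (expansion r (star l)) G = {}"
  shows "card (cliques s r G) \<le>
    2 ^ ((r - 2) * ((l - 1) * (r - 1) + 1) ^ (s * s)) * card (verts G) ^ (r - 2)"
proof -
  let ?d = "(l - 1) * (r - 1)" and ?V = "verts G"
  have finV: "finite ?V" using G by (simp add: r_graph_def)
  have "\<exists>T. finite T \<and> v \<notin> T \<and> card T \<le> ?d \<and> (\<forall>e. e \<in> edges G \<longrightarrow> v \<in> e \<longrightarrow> e \<inter> T \<noteq> {})" for v
    by (rule link_cover[OF G _ l free, of v]) (use r in auto)
  then obtain T where T: "\<And>v. finite (T v)" "\<And>v. v \<notin> T v" "\<And>v. card (T v) \<le> ?d"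
    and hit: "\<And>v e. e \<in> edges G \<Longrightarrow> v \<in> e \<Longrightarrow> e \<inter> T v \<noteq> {}"
    by metis
  define B where "B R = (ball_step T ^^ (s * s)) R" for R
  define Q where "Q = {R. R \<subseteq> ?V \<and> card R = r - 2}"
  have "finite Q" using finV by (simp add: Q_def)
  have B: "finite (B R)" "card (B R) \<le> (r - 2) * (?d + 1) ^ (s * s)" if "R \<in> Q" for R
    using card_ball_step_iterate[of T ?d R "s * s"] T that finV
    by (auto simp: B_def Q_def intro: finite_subset)
  have "cliques s r G \<subseteq> (\<Union>R\<in>Q. Pow (B R))"
  proof
    fix K assume "K \<in> cliques s r G"
    then have K: "finite K" "K \<subseteq> ?V" "card K = s"
      and clique: "\<And>e. e \<subseteq> K \<Longrightarrow> card e = r \<Longrightarrow> e \<in> edges G"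
      by (auto simp: cliques_def)
    have deg: "v \<notin> T v \<and> card (K \<inter> T v) \<ge> s - r + 1" if v: "v \<in> K" for v
    proof -
      \<comment> \<open>Otherwise \<open>v\<close> together with \<open>r - 1\<close> such vertices
        would form an edge through \<open>v\<close> that misses \<open>T v\<close>.\<close>
      have "card (K - {v} - T v) < r - 1"
      proof (rule ccontr)
        assume "\<not> card (K - {v} - T v) < r - 1"
        then obtain S where S: "S \<subseteq> K - {v} - T v" "card S = r - 1" "finite S"
          by (metis not_less obtain_subset_with_card_n)
        then have "card (insert v S) = r" using r by (subst card_insert_disjoint) auto
        then have "insert v S \<in> edges G" using S v by (intro clique) auto
        then show False using hit[of "insert v S" v] S T(2)[of v] by blast
      qed
      moreover have "card (K - {v}) = s - 1" using K v by simp
      moreover have "card (K - {v}) = card (K \<inter> T v) + card (K - {v} - T v)"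
      proof -
        have "K - {v} = (K \<inter> T v) \<union> (K - {v} - T v)" using T(2)[of v] by blast
        moreover have "card ((K \<inter> T v) \<union> (K - {v} - T v)) = card (K \<inter> T v) + card (K - {v} - T v)"
          using K by (intro card_Un_disjoint) auto
        ultimately show ?thesis by simp
      qed
      ultimately show ?thesis using T(2) s r by auto
    qed
    \<comment> \<open>With \<open>m = s - r + 1\<close>, the requirement
      \<open>m + 2 \<le> card K\<close> amounts to \<open>r \<ge> 3\<close>, and \<open>R\<close>
      gets at most \<open>r - 2\<close> elements. It is then padded inside \<open>K\<close> to
      exactly \<open>r - 2\<close>.\<close>
    obtain R where R: "R \<subseteq> K" "card R + (s - r + 1) + 1 \<le> card K" "K \<subseteq> (arcs_in K T)\<^sup>* `` R"
      by (rule small_generating_set[of K "s - r + 1" T]) (use K deg r s in auto)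
    then have "card R \<le> r - 2" "r - 2 \<le> card K" using K s r by auto
    then obtain R' where R': "R \<subseteq> R'" "R' \<subseteq> K" "card R' = r - 2"
      using exists_subset_between[of R "r - 2" K] R(1) K(1) by blast
    have "K \<subseteq> (arcs_in K T)\<^sup>* `` R'" using R(3) R'(1) by blast
    then have "K \<subseteq> B R'" using subset_ball_step_iterate[OF K(1)] K(3) by (auto simp: B_def)
    moreover have "R' \<in> Q" using R' K by (auto simp: Q_def)
    ultimately show "K \<in> (\<Union>R\<in>Q. Pow (B R))" by blast
  qed
  then have "card (cliques s r G) \<le> card (\<Union>R\<in>Q. Pow (B R))"
    using \<open>finite Q\<close> B by (intro card_mono) auto
  also have "\<dots> \<le> (\<Sum>R\<in>Q. card (Pow (B R)))" by (rule card_UN_le[OF \<open>finite Q\<close>])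
  also have "\<dots> \<le> (\<Sum>R\<in>Q. 2 ^ ((r - 2) * (?d + 1) ^ (s * s)))"
    using B by (intro sum_mono) (simp add: card_Pow)
  also have "\<dots> = 2 ^ ((r - 2) * (?d + 1) ^ (s * s)) * (card ?V choose (r - 2))"
    using finV by (simp add: Q_def n_subsets)
  also have "\<dots> \<le> 2 ^ ((r - 2) * (?d + 1) ^ (s * s)) * card ?V ^ (r - 2)"
    by (intro mult_left_mono, cases "r - 2 \<le> card ?V") (auto simp: binomial_le_pow binomial_eq_0)
  finally show ?thesis .
qed

section \<open>The lower bound\<close>

definition core_graph :: "nat \<Rightarrow> nat \<Rightarrow> nat \<Rightarrow> nat hgraph" where
  "core_graph a r n = ({..<n}, {e. e \<subseteq> {..<n} \<and> card e = r \<and> card (e \<inter> {..<a}) \<ge> 2})"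

lemma core_graph_star_free:
  assumes "a \<le> l" "l \<ge> 1"
  shows "copies (expansion r (star l)) (core_graph a r n) = {}"
proof (rule ccontr)
  assume "copies (expansion r (star l)) (core_graph a r n) \<noteq> {}"
  then obtain v f where f: "\<And>i. i \<in> {1..l} \<Longrightarrow> f i \<in> edges (core_graph a r n) \<and> v \<in> f i"
    and disj: "\<And>i j. i \<in> {1..l} \<Longrightarrow> j \<in> {1..l} \<Longrightarrow> i \<noteq> j \<Longrightarrow> f i \<inter> f j = {v}"
    by (rule copies_expansion_starD) metis
  \<comment> \<open>Each edge has a core vertex other than \<open>v\<close>. As \<open>a \<le> l\<close>, these exhaust the core, so \<open>v\<close> is
    not in the core and no second core vertex is left for \<open>f 1\<close>.\<close>
  have "\<exists>x. x \<in> f i \<inter> {..<a} - {v}" if "i \<in> {1..l}" for i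
  proof -
    have "card (f i \<inter> {..<a}) \<ge> 2" using f[OF that] by (simp add: core_graph_def)
    then have "\<not> f i \<inter> {..<a} \<subseteq> {v}"
      using card_mono[of "{v}" "f i \<inter> {..<a}"] by auto
    then show ?thesis by blast
  qed
  then obtain x where x: "\<And>i. i \<in> {1..l} \<Longrightarrow> x i \<in> f i \<inter> {..<a} - {v}" by metis
  have "inj_on x {1..l}"
  proof (rule inj_onI, rule ccontr)
    fix i j assume ij: "i \<in> {1..l}" "j \<in> {1..l}" "x i = x j" "i \<noteq> j"
    then show False using x[OF ij(1)] x[OF ij(2)] disj[OF ij(1,2,4)] by auto
  qed
  then have card_x: "card (x ` {1..l}) = l" by (simp add: card_image)
  have "x ` {1..l} \<subseteq> {..<a}" using x by auto
  then have "x ` {1..l} = {..<a}"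
    using card_x assms by (intro card_seteq) auto
  have "card (f 1 \<inter> {..<a}) \<ge> 2" using f[of 1] assms by (simp add: core_graph_def)
  then have "\<not> f 1 \<inter> {..<a} \<subseteq> {x 1}"
    using card_mono[of "{x 1}" "f 1 \<inter> {..<a}"] by auto
  then obtain y where y: "y \<in> f 1" "y \<in> {..<a}" "y \<noteq> x 1" by blast
  then obtain j where j: "j \<in> {1..l}" "y = x j" using \<open>x ` {1..l} = {..<a}\<close> by blast
  \<comment> \<open>Since \<open>y \<noteq> x 1\<close>, the index \<open>j\<close> is not 1; so
    \<open>y\<close> lies in \<open>f 1 \<inter> f j = {v}\<close>, although
    \<open>x j \<noteq> v\<close>.\<close>
  then show False using disj[of 1 j] x[OF j(1)] y assms by auto
qed

text \<open>Join the core to any \<open>r - 2\<close> vertices outside it: this gives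
  \<open>s\<close> vertices, and an \<open>r\<close>-subset has at most \<open>r - 2\<close> of them
  outside the core, hence at least two inside. Different choices give different cliques.\<close>

lemma card_cliques_core_graph_ge:
  assumes "r \<ge> 2" "s \<ge> r" "n \<ge> s - r + 2"
  shows "card (cliques s r (core_graph (s - r + 2) r n)) \<ge> (n - (s - r + 2)) choose (r - 2)"
proof -
  let ?a = "s - r + 2"
  let ?Q = "{S. S \<subseteq> {?a..<n} \<and> card S = r - 2}" and ?C = "cliques s r (core_graph ?a r n)"
  have "(\<lambda>S. {..<?a} \<union> S) ` ?Q \<subseteq> ?C"
  proof clarify
    fix S assume S: "S \<subseteq> {?a..<n}" "card S = r - 2"
    then have finS: "finite S" by (meson finite_atLeastLessThan finite_subset)
    have "card ({..<?a} \<union> S) = s"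
      using S finS assms by (subst card_Un_disjoint) auto
    moreover have "card (e \<inter> {..<?a}) \<ge> 2" if e: "e \<subseteq> {..<?a} \<union> S" "card e = r" for e
    proof -
      have "e \<subseteq> (e \<inter> {..<?a}) \<union> S" using e by auto
      then have "card e \<le> card ((e \<inter> {..<?a}) \<union> S)" using finS by (intro card_mono) auto
      also have "\<dots> \<le> card (e \<inter> {..<?a}) + card S" by (rule card_Un_le)
      finally show ?thesis using e S assms by simp
    qed
    ultimately show "{..<?a} \<union> S \<in> ?C"
      using S finS assms by (fastforce simp: cliques_def core_graph_def)
  qed
  moreover have "finite ?C"
    by (rule finite_subset[of _ "Pow {..<n}"]) (auto simp: cliques_def core_graph_def)
  ultimately have "card ((\<lambda>S. {..<?a} \<union> S) ` ?Q) \<le> card ?C" by (intro card_mono)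
  moreover have "inj_on (\<lambda>S. {..<?a} \<union> S) ?Q"
  proof (rule inj_onI)
    fix S S' assume S: "S \<in> ?Q" "S' \<in> ?Q" "{..<?a} \<union> S = {..<?a} \<union> S'"
    then have "S = ({..<?a} \<union> S) - {..<?a}" "S' = ({..<?a} \<union> S') - {..<?a}" by auto
    then show "S = S'" using S(3) by simp
  qed
  ultimately show ?thesis by (simp add: card_image n_subsets)
qed

theorem theorem2p5:
  fixes s r l :: nat
  assumes "r \<ge> 3" and "s \<ge> r" and "l \<ge> 2"
  shows "(\<exists>c::real. \<forall>\<^sub>F n in sequentially.
            real (ex_r r n (complete_r_graph s r) (expansion r (star l))) \<le> c * real n ^ (r - 2))
       \<and> (s \<le> l + r - 2 \<longrightarrow>
            (\<lambda>n. real (ex_r r n (complete_r_graph s r) (expansion r (star l))))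
              \<in> \<Theta>(\<lambda>n. real n ^ (r - 2)))"
proof -
  let ?F = "expansion r (star l)" and ?k = "r - 2"
  let ?ex = "\<lambda>n. ex_r r n (complete_r_graph s r) ?F"
  \<comment> \<open>The constant from \<open>card_cliques_le\<close>, independent of
    \<open>n\<close>. The bound with it holds for every \<open>n\<close> and yields both the first
    claim and the \<open>O\<close> half of the second.\<close>
  define C :: nat where "C = 2 ^ ((r - 2) * ((l - 1) * (r - 1) + 1) ^ (s * s))"
  have F: "edges ?F \<noteq> {}" using assms by (auto simp: edges_expansion_star)
  have upper_nat: "?ex n \<le> C * n ^ ?k" for n
    unfolding ex_r_def
  proof (subst Max_le_iff[OF finite_ex_r_values ex_r_values_nonempty[OF F]], clarify)
    fix V :: "nat set" and E
    assume "r_graph r (V, E)" "copies ?F (V, E) = {}"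
    then show "card (copies (complete_r_graph s r) (V, E)) \<le> C * card (verts (V, E)) ^ ?k"
      unfolding card_copies_complete C_def using assms by (intro card_cliques_le) auto
  qed
  have upper: "real (?ex n) \<le> real C * real n ^ ?k" for n
    using upper_nat[of n] by (metis of_nat_le_iff of_nat_mult of_nat_power)
  have "(\<lambda>n. real (?ex n)) \<in> \<Theta>(\<lambda>n. real n ^ ?k)" if "s \<le> l + r - 2"
  proof
    show "(\<lambda>n. real (?ex n)) \<in> O(\<lambda>n. real n ^ ?k)"
      using upper by (intro bigoI[of _ "real C"]) auto
    define a where "a = s - r + 2"
    \<comment> \<open>The condition on \<open>s\<close> says exactly that the core is small enough
      for \<open>core_graph_star_free\<close>.\<close>
    have a: "a \<le> l" using that assms by (simp add: a_def)
    \<comment> \<open>The threshold ensures both \<open>n - a \<ge> n / 2\<close> and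
      \<open>n - a \<ge> ?k\<close>; the latter allows the estimate of the binomial coefficient by
      \<open>((n - a) / ?k) ^ ?k\<close>.\<close>
    have "real n ^ ?k / (2 * real ?k) ^ ?k \<le> real (?ex n)" if n: "n \<ge> 2 * a + ?k" for n
    proof -
      have "r_graph r (core_graph a r n)" "card (verts (core_graph a r n)) = n"
        by (auto simp: r_graph_def core_graph_def)
      moreover have "copies ?F (core_graph a r n) = {}"
        using a assms by (intro core_graph_star_free) auto
      ultimately have "card (copies (complete_r_graph s r) (core_graph a r n)) \<le> ?ex n"
        unfolding ex_r_def by (intro Max_ge[OF finite_ex_r_values]) blast
      moreover have "(n - a) choose ?k \<le> card (cliques s r (core_graph a r n))"
        unfolding a_def using assms n a_def by (intro card_cliques_core_graph_ge) auto
      ultimately have ge: "(n - a) choose ?k \<le> ?ex n" by (simp add: card_copies_complete)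
      have "real n ^ ?k / (2 * real ?k) ^ ?k = (real n / 2 / real ?k) ^ ?k"
        by (simp add: power_divide)
      also have "\<dots> \<le> (real (n - a) / real ?k) ^ ?k"
        using n by (intro power_mono divide_right_mono) (auto simp: of_nat_diff)
      also have "\<dots> \<le> real ((n - a) choose ?k)"
        using n by (intro binomial_ge_n_over_k_pow_k) auto
      also have "\<dots> \<le> real (?ex n)" using ge by simp
      finally show ?thesis .
    qed
    then have "\<forall>\<^sub>F n in sequentially. real n ^ ?k / (2 * real ?k) ^ ?k \<le> real (?ex n)"
      by (auto simp: eventually_sequentially)
    then have "\<forall>\<^sub>F n in sequentially. norm (real (?ex n)) \<ge> 1 / (2 * real ?k) ^ ?k * norm (real n ^ ?k)"
      by eventually_elim simp
    then show "(\<lambda>n. real (?ex n)) \<in> \<Omega>(\<lambda>n. real n ^ ?k)"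
      using assms by (intro landau_omega.bigI[of "1 / (2 * real ?k) ^ ?k"]) auto
  qed
  then show ?thesis using upper by (auto intro!: exI[of _ "real C"])
qed

end
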